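(* Let $\Delta=\mathrm{diag}(b_1,b_2,b_3)$ with $b_1,b_2,b_3$ distinct nonzero complex numbers. Let $x,y,q_1,q_1',q_{2,1}^2,q_{2,2}^2,q_{3,1}^3,q_{3,2}^3\in\mathbb C$ with $xy\ne0$ and $q_1\ne0$, and let $\mathcal L\subset M_3[\mathbb C]$ be the 5-dimensional subspace with (canonical) basis $$L_1=\begin{bmatrix}1&0&0\\ x&0&0\\ y&0&0\end{bmatrix},\quad L_2=\begin{bmatrix}0&1&0\\ b_\Delta(3)x&x&0\\ b_\Delta(2)y&y&0\end{bmatrix},\quad Q_1'=\begin{bmatrix}0&0&1\\ q_1'&q_1&0\\ \frac yxq_1'+\frac yxb_\Delta(1)q_1&\frac yxq_1&0\end{bmatrix},$$ $$Q_2=\begin{bmatrix}0&0&0\\ q_{2,1}^2&q_{2,2}^2&1\\ 0&0&0\end{bmatrix},\quad Q_3=\begin{bmatrix}0&0&0\\ 0&0&0\\ q_{3,1}^3&q_{3,2}^3&1\end{bmatrix}.$$ Then $\mathcal L$ is $\Delta$-singular if and only if all of the following hold: (i) $q_{2,2}^2=b_\Delta(3)-q_1/x$; (ii) $q_{2,1}^2=b_\Delta(3)/b_2-q_1'/x$; (iii) $q_{3,2}^3=b_\Delta(2)-q_1/x$; (iv) $q_{3,1}^3=b_\Delta(2)/b_3-b_\Delta(1)q_1/x-q_1'/x$.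
   Context: $M_3[\mathbb C]$ is the space of $3\times3$ complex matrices. $b_\Delta(1)=\frac1{b_3}-\frac1{b_2}$, $b_\Delta(2)=\frac1{b_3}-\frac1{b_1}$, $b_\Delta(3)=\frac1{b_2}-\frac1{b_1}$. With $J=\begin{bmatrix}0&0&0\\ 1&0&0\\ 0&1&0\end{bmatrix}$, a subspace $\mathcal L\subset M_3[\mathbb C]$ is $\Delta$-singular if $\det(\Delta X-XJ)=0$ for all $X\in\mathcal L$. Superscripts on the $q$'s are indices, not powers; $q_1'$ is a parameter independent of $q_1$. *)

theory Defs
  imports "HOL-Analysis.Analysis"
begin

text \<open>
  Analysis makes \<^typ>\<open>complex^3^3\<close> only a real vector space, so its structure over the
  complex field is set up here; span, dimension and independence below are the complex ones.
\<close>

definition cmat_scale :: "complex \<Rightarrow> complex^3^3 \<Rightarrow> complex^3^3" where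
  "cmat_scale c A = map_matrix ((*) c) A"

interpretation cmat: vector_space cmat_scale
  by unfold_locales (simp_all add: cmat_scale_def vec_eq_iff algebra_simps)

definition diag_matrix :: "complex^3 \<Rightarrow> complex^3^3" where
  "diag_matrix b = (\<chi> i j. if i = j then b $ i else 0)"

definition shift_J :: "complex^3^3" where
  "shift_J = vector [vector [0, 0, 0], vector [1, 0, 0], vector [0, 1, 0]]"

text \<open>The index type \<^typ>\<open>3\<close> has exactly the elements 1, 2 and 3, so the last case is 3.\<close>

definition b_Delta :: "complex^3 \<Rightarrow> 3 \<Rightarrow> complex" where
  "b_Delta b i =
     (if i = 1 then 1 / b $ 3 - 1 / b $ 2
      else if i = 2 then 1 / b $ 3 - 1 / b $ 1
      else 1 / b $ 2 - 1 / b $ 1)"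

definition Delta_singular :: "complex^3^3 \<Rightarrow> (complex^3^3) set \<Rightarrow> bool" where
  "Delta_singular \<Delta> L \<longleftrightarrow> (\<forall>X\<in>L. det (\<Delta> ** X - X ** shift_J) = 0)"

text \<open>
  Five matrices with the pattern of leading ones considered here are always linearly
  independent, so a span of such matrices is 5-dimensional without further hypotheses.
\<close>

lemma canonical_basis:
  fixes L1 L2 Q1 Q2 Q3 :: "complex^3^3"
  assumes L1: "L1 = vector [vector [1, 0, 0], vector [a1, 0, 0], vector [a2, 0, 0]]"
    and L2: "L2 = vector [vector [0, 1, 0], vector [c1, c2, 0], vector [c3, c4, 0]]"
    and Q1: "Q1 = vector [vector [0, 0, 1], vector [d1, d2, 0], vector [d3, d4, 0]]"
    and Q2: "Q2 = vector [vector [0, 0, 0], vector [e1, e2, 1], vector [0, 0, 0]]"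
    and Q3: "Q3 = vector [vector [0, 0, 0], vector [0, 0, 0], vector [f1, f2, 1]]"
  shows "cmat.independent {L1, L2, Q1, Q2, Q3}"
    and "cmat.dim (cmat.span {L1, L2, Q1, Q2, Q3}) = 5"
proof -
  note entries = L1 L2 Q1 Q2 Q3
  have ne: "L1 \<noteq> L2" "L1 \<noteq> Q1" "L1 \<noteq> Q2" "L1 \<noteq> Q3" "L2 \<noteq> Q1" "L2 \<noteq> Q2" "L2 \<noteq> Q3"
    "Q1 \<noteq> Q2" "Q1 \<noteq> Q3" "Q2 \<noteq> Q3"
    by (auto simp: entries vec_eq_iff forall_3)
  show ind: "cmat.independent {L1, L2, Q1, Q2, Q3}"
  proof (rule cmat.independent_if_scalars_zero)
    fix u X
    assume "(\<Sum>X\<in>{L1, L2, Q1, Q2, Q3}. cmat_scale (u X) X) = 0"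
      and X: "X \<in> {L1, L2, Q1, Q2, Q3}"
    then have s: "cmat_scale (u L1) L1 + cmat_scale (u L2) L2 + cmat_scale (u Q1) Q1
        + cmat_scale (u Q2) Q2 + cmat_scale (u Q3) Q3 = 0"
      using ne by (simp add: add.assoc)
    have e: "u L1 * L1 $ i $ j + u L2 * L2 $ i $ j + u Q1 * Q1 $ i $ j
        + u Q2 * Q2 $ i $ j + u Q3 * Q3 $ i $ j = 0" for i j
      using arg_cong[OF s, of "\<lambda>A. A $ i $ j"] by (simp add: cmat_scale_def)
    have t: "L1 $ 1 $ 1 = 1" "L2 $ 1 $ 1 = 0" "Q1 $ 1 $ 1 = 0" "Q2 $ 1 $ 1 = 0" "Q3 $ 1 $ 1 = 0"
      "L1 $ 1 $ 2 = 0" "L2 $ 1 $ 2 = 1" "Q1 $ 1 $ 2 = 0" "Q2 $ 1 $ 2 = 0" "Q3 $ 1 $ 2 = 0"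
      "L1 $ 1 $ 3 = 0" "L2 $ 1 $ 3 = 0" "Q1 $ 1 $ 3 = 1" "Q2 $ 1 $ 3 = 0" "Q3 $ 1 $ 3 = 0"
      "L1 $ 2 $ 3 = 0" "L2 $ 2 $ 3 = 0" "Q1 $ 2 $ 3 = 0" "Q2 $ 2 $ 3 = 1" "Q3 $ 2 $ 3 = 0"
      "L1 $ 3 $ 3 = 0" "L2 $ 3 $ 3 = 0" "Q1 $ 3 $ 3 = 0" "Q2 $ 3 $ 3 = 0" "Q3 $ 3 $ 3 = 1"
      by (simp_all add: entries)
    from e[of 1 1] e[of 1 2] e[of 1 3] e[of 2 3] e[of 3 3] X show "u X = 0"
      by (auto simp only: t mult_zero_right mult_1_right add_0_left add_0_right)
  qed simp
  show "cmat.dim (cmat.span {L1, L2, Q1, Q2, Q3}) = 5"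
    using cmat.dim_eq_card_independent[OF ind] ne by (simp add: cmat.dim_span)
qed

end

theory Submission
  imports Defs
begin

text \<open>
  Let \<open>X\<close> have coordinates \<open>a, c, d, e, f\<close> in the canonical basis, and let \<open>R\<^sub>i\<close> be the \<open>i\<close>-th row
  of \<open>\<Delta>X - XJ\<close> divided by \<open>b\<^sub>i\<close>. With \<open>N = (q\<^sub>1'/x - q\<^sub>1/(x b\<^sub>2), q\<^sub>1/x + 1/b\<^sub>1, -1)\<close> one finds
  \<open>R\<^sub>2 = x R\<^sub>1 + (x d - e) N + e U\<close> and \<open>R\<^sub>3 = y R\<^sub>1 + (y d - f) N + f V\<close>, where \<open>U\<close> and \<open>V\<close> have last
  entry 0; \<open>U = 0\<close> expresses (i) and (ii), \<open>V = 0\<close> expresses (iii) and (iv). If \<open>U = V = 0\<close> the three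
  rows lie in the plane spanned by \<open>R\<^sub>1\<close> and \<open>N\<close>. Conversely, for \<open>f = 0\<close> the determinant is
  \<open>d e y\<close> times the determinant of \<open>R\<^sub>1, U, N\<close>, for \<open>e = 0\<close> it is \<open>d f x\<close> times that of
  \<open>R\<^sub>1, N, V\<close>, and varying \<open>a\<close> and \<open>c\<close> forces \<open>U = 0\<close> and \<open>V = 0\<close>.
\<close>

lemma cmat_span_5:
  "X \<in> cmat.span {A, B, C, D, E} \<longleftrightarrow>
    (\<exists>a c d e f. X = cmat_scale a A + cmat_scale c B + cmat_scale d C + cmat_scale e D + cmat_scale f E)"
proof -
  have "X - cmat_scale a A - cmat_scale c B - cmat_scale d C - cmat_scale e D - cmat_scale f E = 0
      \<longleftrightarrow> X = cmat_scale a A + cmat_scale c B + cmat_scale d C + cmat_scale e D + cmat_scale f E"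
    for a c d e f
    by (auto simp: algebra_simps)
  then show ?thesis
    by (simp add: cmat.span_breakdown_eq)
qed

text \<open>Right multiplication by \<open>shift_J\<close> moves columns one place left, so
  \<open>b $ i\<close> factors out of row \<open>i\<close>.\<close>

lemma det_Delta_shift:
  fixes X :: "complex^3^3"
  assumes "b $ 1 \<noteq> 0" "b $ 2 \<noteq> 0" "b $ 3 \<noteq> 0"
  shows "det (diag_matrix b ** X - X ** shift_J) = b $ 1 * b $ 2 * b $ 3 *
    det (vector
      [vector [X $ 1 $ 1 - X $ 1 $ 2 / b $ 1, X $ 1 $ 2 - X $ 1 $ 3 / b $ 1, X $ 1 $ 3],
       vector [X $ 2 $ 1 - X $ 2 $ 2 / b $ 2, X $ 2 $ 2 - X $ 2 $ 3 / b $ 2, X $ 2 $ 3],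
       vector [X $ 3 $ 1 - X $ 3 $ 2 / b $ 3, X $ 3 $ 2 - X $ 3 $ 3 / b $ 3, X $ 3 $ 3]] :: complex^3^3)"
    (is "_ = _ * det ?M")
proof -
  have eq: "diag_matrix b ** X - X ** shift_J = (\<chi> i. b $ i *s ?M $ i)"
    using assms
    by (simp add: vec_eq_iff forall_3 matrix_matrix_mult_def sum_3 diag_matrix_def shift_J_def
        right_diff_distrib)
  show ?thesis
    unfolding eq det_rows_mul[of "($) b" "($) ?M"] vec_nth_inverse unfolding UNIV_3 by simp
qed

text \<open>Modulo the first row the others are \<open>k N + e U\<close> and
  \<open>l N + f V\<close>; expanding by multilinearity, the \<open>k * l\<close> term repeats
  \<open>N\<close> and vanishes.\<close>

lemma det_combined_rows:
  fixes A C d e f k l x y m n u u' v v' :: "'a :: comm_ring_1"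
  shows "det (vector
      [vector [A, C, d],
       vector [x * A + k * m + e * u', x * C + k * n + e * u, x * d - k],
       vector [y * A + l * m + f * v', y * C + l * n + f * v, y * d - l]] :: 'a^3^3) =
    f * k * ((A + d * m) * v - (C + d * n) * v') - e * l * ((A + d * m) * u - (C + d * n) * u')
    + d * e * f * (u' * v - u * v')"
  unfolding det_3 vector_3 by (simp add: algebra_simps)

theorem theorem41:
  fixes b :: "complex^3"
    and x y q1 q1' q2_1 q2_2 q3_1 q3_2 :: complex
    and L1 L2 Q1' Q2 Q3 :: "complex^3^3"
    and L :: "(complex^3^3) set"
  assumes nonzero: "b $ 1 \<noteq> 0" "b $ 2 \<noteq> 0" "b $ 3 \<noteq> 0"
    and distinct: "b $ 1 \<noteq> b $ 2" "b $ 1 \<noteq> b $ 3" "b $ 2 \<noteq> b $ 3"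
    and xy: "x * y \<noteq> 0"
    and q1: "q1 \<noteq> 0"
    and L1: "L1 = vector
      [vector [1, 0, 0],
       vector [x, 0, 0],
       vector [y, 0, 0]]"
    and L2: "L2 = vector
      [vector [0, 1, 0],
       vector [b_Delta b 3 * x, x, 0],
       vector [b_Delta b 2 * y, y, 0]]"
    and Q1': "Q1' = vector
      [vector [0, 0, 1],
       vector [q1', q1, 0],
       vector [y / x * q1' + y / x * b_Delta b 1 * q1, y / x * q1, 0]]"
    and Q2: "Q2 = vector
      [vector [0, 0, 0],
       vector [q2_1, q2_2, 1],
       vector [0, 0, 0]]"
    and Q3: "Q3 = vector
      [vector [0, 0, 0],
       vector [0, 0, 0],
       vector [q3_1, q3_2, 1]]"
    and L: "L = cmat.span {L1, L2, Q1', Q2, Q3}"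
  shows "Delta_singular (diag_matrix b) L \<longleftrightarrow>
      q2_2 = b_Delta b 3 - q1 / x \<and>
      q2_1 = b_Delta b 3 / b $ 2 - q1' / x \<and>
      q3_2 = b_Delta b 2 - q1 / x \<and>
      q3_1 = b_Delta b 2 / b $ 3 - b_Delta b 1 * q1 / x - q1' / x"
proof -
  have x: "x \<noteq> 0" and y: "y \<noteq> 0" using xy by auto
  define m where "m = q1' / x - q1 / x / b $ 2"
  define n where "n = q1 / x + 1 / b $ 1"
  \<comment> \<open>\<open>u\<close>, \<open>v\<close> are the defects in (i), (iii); the shift
    subtracts \<open>u / b $ 2\<close>, \<open>v / b $ 3\<close> from those in (ii), (iv).\<close>
  define u where "u = q2_2 - (b_Delta b 3 - q1 / x)"
  define u' where "u' = q2_1 - (b_Delta b 3 / b $ 2 - q1' / x) - u / b $ 2"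
  define v where "v = q3_2 - (b_Delta b 2 - q1 / x)"
  define v' where "v' = q3_1 - (b_Delta b 2 / b $ 3 - b_Delta b 1 * q1 / x - q1' / x) - v / b $ 3"
  define P where "P a c d e f =
    f * (x * d - e) * ((a - c / b $ 1 + d * m) * v - (c - d / b $ 1 + d * n) * v')
    - e * (y * d - f) * ((a - c / b $ 1 + d * m) * u - (c - d / b $ 1 + d * n) * u')
    + d * e * f * (u' * v - u * v')" for a c d e f
  have D: "b_Delta b 1 = 1 / b $ 3 - 1 / b $ 2" "b_Delta b 2 = 1 / b $ 3 - 1 / b $ 1"
    "b_Delta b 3 = 1 / b $ 2 - 1 / b $ 1"
    by (simp_all add: b_Delta_def)
  have det: "det (diag_matrix b ** X - X ** shift_J) = b $ 1 * b $ 2 * b $ 3 * P a c d e f"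
    if X: "X = cmat_scale a L1 + cmat_scale c L2 + cmat_scale d Q1' + cmat_scale e Q2 + cmat_scale f Q3"
    for X a c d e f
  proof -
    have entries: "X $ 1 $ 1 = a" "X $ 1 $ 2 = c" "X $ 1 $ 3 = d"
      "X $ 2 $ 1 = a * x + c * (b_Delta b 3 * x) + d * q1' + e * q2_1"
      "X $ 2 $ 2 = c * x + d * q1 + e * q2_2"
      "X $ 2 $ 3 = e"
      "X $ 3 $ 1 = a * y + c * (b_Delta b 2 * y) + d * (y / x * q1' + y / x * b_Delta b 1 * q1) + f * q3_1"
      "X $ 3 $ 2 = c * y + d * (y / x * q1) + f * q3_2"
      "X $ 3 $ 3 = f"
      by (simp_all add: X L1 L2 Q1' Q2 Q3 cmat_scale_def)
    \<comment> \<open>Both rows share the same \<open>m\<close> because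
      \<open>b_Delta b 1 - 1 / b $ 3 = - 1 / b $ 2\<close>.\<close>
    have
      "X $ 2 $ 3 = x * d - (x * d - e)" "X $ 3 $ 3 = y * d - (y * d - f)"
      "X $ 2 $ 1 - X $ 2 $ 2 / b $ 2 = x * (a - c / b $ 1) + (x * d - e) * m + e * u'"
      "X $ 2 $ 2 - X $ 2 $ 3 / b $ 2 = x * (c - d / b $ 1) + (x * d - e) * n + e * u"
      "X $ 3 $ 1 - X $ 3 $ 2 / b $ 3 = y * (a - c / b $ 1) + (y * d - f) * m + f * v'"
      "X $ 3 $ 2 - X $ 3 $ 3 / b $ 3 = y * (c - d / b $ 1) + (y * d - f) * n + f * v"
      using x nonzero
      by (simp_all add: entries m_def n_def u_def u'_def v_def v'_def D field_simps)
    with entries(1-3) show ?thesis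
      by (simp only: det_Delta_shift[OF nonzero] det_combined_rows P_def)
  qed
  have "Delta_singular (diag_matrix b) L \<longleftrightarrow> (\<forall>a c d e f. P a c d e f = 0)"
  proof -
    have "Delta_singular (diag_matrix b) L \<longleftrightarrow>
        (\<forall>a c d e f. b $ 1 * b $ 2 * b $ 3 * P a c d e f = 0)"
      unfolding Delta_singular_def L cmat_span_5 Ball_def using det by metis
    then show ?thesis using nonzero by simp
  qed
  also have "\<dots> \<longleftrightarrow> u = 0 \<and> u' = 0 \<and> v = 0 \<and> v' = 0"
  proof
    assume P: "\<forall>a c d e f. P a c d e f = 0"
    \<comment> \<open>Differences in \<open>a\<close> and \<open>c\<close> cancel the offsets
      \<open>d * m\<close> and \<open>d * n\<close>.\<close>
    have "P 1 0 1 1 0 - P 0 0 1 1 0 = - (y * u)"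
      "P 0 1 1 1 0 - P 0 0 1 1 0 = y * (u' + u / b $ 1)"
      "P 1 0 1 0 1 - P 0 0 1 0 1 = x * v"
      "P 0 1 1 0 1 - P 0 0 1 0 1 = - (x * (v' + v / b $ 1))"
      by (simp_all add: P_def algebra_simps)
    with P x y show "u = 0 \<and> u' = 0 \<and> v = 0 \<and> v' = 0" by simp
  qed (simp add: P_def)
  finally show ?thesis
    by (auto simp: u_def u'_def v_def v'_def)
qed

end
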